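(* Let $\mathcal{E}\le F$ be the planar $3$-colorable subgroup and $\mathcal{F}\le F$ the $3$-colorable subgroup of Thompson's group $F$. Then $$\mathcal{E}=\langle x_0,\varphi_R(\mathcal{F})\rangle=\langle x_0,\varphi_L(\mathcal{F})\rangle .$$
   Context: Thompson's group $F$ is the group of piecewise linear homeomorphisms of $[0,1]$ differentiable except at finitely many dyadic rationals, with all slopes powers of $2$; the product is $(f\cdot g)(t)=g(f(t))$. In binary expansions, $x_0$ is the element $.00\alpha\mapsto .0\alpha$, $.01\alpha\mapsto .10\alpha$, $.1\alpha\mapsto .11\alpha$. Tree diagrams: a tree diagram is a pair $(T_+,T_-)$ of finite planar rooted binary trees with the same number $n$ of leaves. Vertices are finite binary words (root = empty word, $v0$ and $v1$ = left and right child of $v$). It represents the element of $F$ sending $.\alpha_k\gamma$ to $.\beta_k\gamma$ for each $k$ and each infinite binary word $\gamma$, where $\alpha_k,\beta_k$ are the $k$-th leaves (from left to right) of $T_+,T_-$. Every element of $F$ is so represented, uniquely up to inserting/deleting pairs of opposing carets. One draws $T_-$ upside down below $T_+$ and identifies the $k$-th leaves of the two trees. Planar $3$-colorable subgroup $\mathcal{E}$: ignoring edges sprouting upward/downward from the two roots, the diagram partitions the plane into regions: the outer region $R_0=R_n$ and, for $1\le i\le n-1$, the region $R_i$ between the $i$-th and $(i+1)$-th leaves. If $v$ is a non-root vertex of $T_+$ or $T_-$ whose descendant leaves are numbers $p+1,\dots,q$, the edge from $v$ to its parent separates $R_p$ from $R_q$. $\mathcal{E}$ is the subgroup of elements whose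 plane partition is $3$-colorable: there is a map $c$ from the regions to $\mathbb{Z}_3$ giving different colors to regions sharing an edge, i.e. $c(R_p)\neq c(R_q)$ for each such $v$. This does not depend on the tree diagram chosen. $3$-colorable subgroup $\mathcal{F}$: here each root is joined by an edge to the corresponding boundary line of a horizontal strip containing the diagram, so the strip has a leftmost region $R_0$ and a distinct rightmost region $R_n$, besides $R_1,\dots,R_{n-1}$. $\mathcal{F}$ is the subgroup of elements for which the strip is $3$-colorable: there are colors $c(R_0),\dots,c(R_n)\in\mathbb{Z}_3$ with $c(R_p)\ne c(R_q)$ for every vertex $v$ (including the roots) of $T_+$ or $T_-$ with descendant leaves numbered $p+1,\dots,q$. Shift endomorphisms of $F$: $\varphi_R(g)(t)=t$ for $t\in[0,1/2]$ and $\varphi_R(g)(t)=\tfrac12+\tfrac12 g(2t-1)$ for $t\in[1/2,1]$; $\varphi_L(g)(t)=\tfrac12 g(2t)$ for $t\in[0,1/2]$ and $\varphi_L(g)(t)=t$ for $t\in[1/2,1]$. *)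

theory Defs
  imports
    "HOL-Analysis.Analysis"
    "HOL-Algebra.Generated_Groups"
    "HOL-Library.Stream"
    "HOL-Library.Sublist"
    "HOL-Library.Numeral_Type"
begin

section \<open>Thompson's group F\<close>

definition dyadic_rationals :: "real set" where
  "dyadic_rationals = {of_int a / 2 ^ n | (a::int) (n::nat). True}"

text \<open>
  Outside a finite set \<open>B\<close> of dyadic rationals there are no breakpoints: on every interval whose
  interior avoids \<open>B\<close> the map is affine, and its slope is an integer power of 2.
\<close>

definition dyadic_piecewise_linear :: "(real \<Rightarrow> real) \<Rightarrow> bool" where
  "dyadic_piecewise_linear f \<longleftrightarrow>
     (\<exists>B. finite B \<and> B \<subseteq> dyadic_rationals \<and>
        (\<forall>a b. 0 \<le> a \<and> a < b \<and> b \<le> 1 \<and> {a<..<b} \<inter> B = {} \<longrightarrow>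
           (\<exists>k::int. \<forall>t\<in>{a..b}. f t = f a + 2 powi k * (t - a))))"

text \<open>
  Maps of the unit interval are represented by functions that are \<open>undefined\<close> outside it, so that
  equality of group elements is equality of functions. The product applies the left factor first.
\<close>

definition thompson_F :: "(real \<Rightarrow> real) monoid" where
  "thompson_F =
     \<lparr>carrier = {f \<in> extensional {0..1}.
                   (\<exists>g. homeomorphism {0..1} {0..1} f g) \<and> dyadic_piecewise_linear f},
      monoid.mult = (\<lambda>f g. compose {0..1} g f),
      one = (\<lambda>t\<in>{0..1}. t)\<rparr>"


section \<open>Tree diagrams\<close>

text \<open>Binary words are lists over \<open>bool\<close>, with \<open>False\<close> for the digit 0 and \<open>True\<close> for the digit 1.\<close>

datatype bintree = Tip | Caret bintree bintree

primrec vertices :: "bintree \<Rightarrow> bool list set" where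
  "vertices Tip = {[]}"
| "vertices (Caret l r) = insert [] (Cons False ` vertices l \<union> Cons True ` vertices r)"

primrec leaves :: "bintree \<Rightarrow> bool list list" where
  "leaves Tip = [[]]"
| "leaves (Caret l r) = map (Cons False) (leaves l) @ map (Cons True) (leaves r)"

definition binary_value :: "bool stream \<Rightarrow> real" where
  "binary_value w = (\<Sum>i. of_bool (w !! i) / 2 ^ Suc i)"

definition tree_diagram :: "bintree \<Rightarrow> bintree \<Rightarrow> bool" where
  "tree_diagram Tpos Tneg \<longleftrightarrow> length (leaves Tpos) = length (leaves Tneg)"

definition represents :: "bintree \<Rightarrow> bintree \<Rightarrow> (real \<Rightarrow> real) \<Rightarrow> bool" where
  "represents Tpos Tneg f \<longleftrightarrow>
     tree_diagram Tpos Tneg \<and>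
     (\<forall>k < length (leaves Tpos). \<forall>\<gamma>.
        f (binary_value (leaves Tpos ! k @- \<gamma>)) = binary_value (leaves Tneg ! k @- \<gamma>))"


section \<open>Colorings\<close>

text \<open>
  The leaves that descend from \<open>v\<close> are exactly those numbered \<open>p + 1, \<dots>, q\<close>. Leaves are numbered
  from 1, whereas list positions start at 0; a leaf is a descendant of itself.
\<close>

definition leaf_span :: "bintree \<Rightarrow> bool list \<Rightarrow> nat \<Rightarrow> nat \<Rightarrow> bool" where
  "leaf_span T v p q \<longleftrightarrow>
     {i \<in> {1..length (leaves T)}. prefix v (leaves T ! (i - 1))} = {p + 1..q}"

text \<open>
  A coloring assigns to \<open>i\<close> the color of the region \<open>R\<^sub>i\<close>; the type \<open>3\<close> is the ring of integers
  modulo 3. In the planar case \<open>R\<^sub>0\<close> and \<open>R\<^sub>n\<close> are the same region, hence the condition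
  \<open>c 0 = c n\<close>.
\<close>

definition planar_three_colorable :: "bintree \<Rightarrow> bintree \<Rightarrow> bool" where
  "planar_three_colorable Tpos Tneg \<longleftrightarrow>
     (\<exists>c :: nat \<Rightarrow> 3.
        c 0 = c (length (leaves Tpos)) \<and>
        (\<forall>T\<in>{Tpos, Tneg}. \<forall>v\<in>vertices T - {[]}. \<forall>p q. leaf_span T v p q \<longrightarrow> c p \<noteq> c q))"

definition strip_three_colorable :: "bintree \<Rightarrow> bintree \<Rightarrow> bool" where
  "strip_three_colorable Tpos Tneg \<longleftrightarrow>
     (\<exists>c :: nat \<Rightarrow> 3.
        \<forall>T\<in>{Tpos, Tneg}. \<forall>v\<in>vertices T. \<forall>p q. leaf_span T v p q \<longrightarrow> c p \<noteq> c q)"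

definition planar_three_colorable_subgroup :: "(real \<Rightarrow> real) set" where
  "planar_three_colorable_subgroup =
     {f \<in> carrier thompson_F. \<exists>Tpos Tneg. represents Tpos Tneg f \<and> planar_three_colorable Tpos Tneg}"

definition three_colorable_subgroup :: "(real \<Rightarrow> real) set" where
  "three_colorable_subgroup =
     {f \<in> carrier thompson_F. \<exists>Tpos Tneg. represents Tpos Tneg f \<and> strip_three_colorable Tpos Tneg}"


section \<open>The generators\<close>

definition shift_R :: "(real \<Rightarrow> real) \<Rightarrow> real \<Rightarrow> real" where
  "shift_R g = (\<lambda>t\<in>{0..1}. if t \<le> 1/2 then t else 1/2 + 1/2 * g (2 * t - 1))"

definition shift_L :: "(real \<Rightarrow> real) \<Rightarrow> real \<Rightarrow> real" where
  "shift_L g = (\<lambda>t\<in>{0..1}. if t \<le> 1/2 then 1/2 * g (2 * t) else t)"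

definition x0 :: "real \<Rightarrow> real" where
  "x0 = (\<lambda>t\<in>{0..1}. if t \<le> 1/4 then 2 * t else if t \<le> 1/2 then t + 1/4 else (t + 1) / 2)"

lemma summable_binary: "summable (\<lambda>i. of_bool (w !! i) / 2 ^ Suc i :: real)"
  by (rule summable_comparison_test[OF _ sums_summable[OF power_half_series]])
     (auto simp: power_one_over field_simps)

lemma binary_value_SCons: "binary_value (b ## w) = (of_bool b + binary_value w) / 2"
proof -
  have "binary_value (b ## w) = of_bool b / 2 + (\<Sum>i. of_bool (w !! i) / 2 ^ Suc (Suc i))"
    unfolding binary_value_def
    using suminf_split_head[OF summable_binary[of "b ## w"]] by simp
  also have "(\<Sum>i. of_bool (w !! i) / 2 ^ Suc (Suc i) :: real)
           = (\<Sum>i. (of_bool (w !! i) / 2 ^ Suc i) / 2)"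
    by (simp add: field_simps)
  also have "\<dots> = binary_value w / 2"
    unfolding binary_value_def by (rule suminf_divide[OF summable_binary])
  finally show ?thesis by (simp add: add_divide_distrib)
qed

lemma binary_value_bounds: "binary_value w \<in> {0..1}"
proof -
  have "binary_value w \<ge> 0"
    unfolding binary_value_def by (rule suminf_nonneg[OF summable_binary]) auto
  moreover have "binary_value w \<le> (\<Sum>i. (1/2) ^ Suc i)"
    unfolding binary_value_def
    by (rule suminf_le[OF _ summable_binary sums_summable[OF power_half_series]])
       (auto simp: power_one_over field_simps)
  ultimately show ?thesis using sums_unique[OF power_half_series] by simp
qed

lemma x0_binary:
  "x0 (binary_value ([False, False] @- w)) = binary_value ([False] @- w)"
  "x0 (binary_value ([False, True] @- w)) = binary_value ([True, False] @- w)"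
  "x0 (binary_value ([True] @- w)) = binary_value ([True, True] @- w)"
  using binary_value_bounds[of w] by (auto simp: x0_def binary_value_SCons field_simps)

lemma represents_x0:
  "represents (Caret (Caret Tip Tip) Tip) (Caret Tip (Caret Tip Tip)) x0"
  using x0_binary
  by (auto simp: represents_def tree_diagram_def less_Suc_eq numeral_3_eq_3)

end

theory Submission imports Defs begin

text \<open>
  A coloring of the regions of a tree is determined by the step across a single edge, since the step
  across the edge of a child is the negative of the step across the edge of its parent. Hence a strip
  is 3-colorable iff corresponding leaves have depths of the same parity, and the planar partition is
  3-colorable iff the parity of depth plus first digit changes by the same amount at all leaves.
  Rotating a tree at the root is multiplication by \<open>x0\<close> and flips that last parity at every leaf. So,
  up to factors \<open>x0\<close> on both sides, each element of the planar subgroup has a diagram whose two trees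
  have a single leaf below the left (or right) child of the root, and such an element is a shift of an
  element of the 3-colorable subgroup.
\<close>

section \<open>Colorings and depth parities\<close>

abbreviation leaf_count :: "bintree \<Rightarrow> nat" where
  "leaf_count T \<equiv> length (leaves T)"

text \<open>The offset \<open>a\<close> places \<open>T\<close> as a subtree whose first leaf has
  number \<open>a + 1\<close> in a larger diagram, which lets the condition pass to
  subtrees.\<close>

definition properly_colors :: "(nat \<Rightarrow> 3) \<Rightarrow> nat \<Rightarrow> bintree \<Rightarrow> bool" where
  "properly_colors c a T \<longleftrightarrow>
     (\<forall>v\<in>vertices T. \<forall>p q. leaf_span T v p q \<longrightarrow> c (a + p) \<noteq> c (a + q))"

definition sign3 :: "bool \<Rightarrow> 3" where
  "sign3 b = (if b then 1 else - 1)"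

lemma sign3_not: "sign3 (\<not> b) = - sign3 b"
  by (simp add: sign3_def)

lemma three_colors: fixes x :: 3 shows "x = 0 \<or> x = 1 \<or> x = - 1"
proof -
  have "(3::3) = 0" "(2::3) = - 1" by simp_all
  with exhaust_3[of x] show ?thesis by metis
qed
text \<open>Going from \<open>x\<close> to \<open>y\<close> through the third color takes two equal
  steps, and doubling is negation modulo 3.\<close>

lemma third_color:
  fixes x y z :: 3
  assumes "x \<noteq> y" "x \<noteq> z" "z \<noteq> y"
  shows "z - x = - (y - x)" "y - z = - (y - x)"
  using assms three_colors[of x] three_colors[of y] three_colors[of z] 
  by (elim disjE; simp)+

lemma double_eq_minus: "- d - d = (d :: 3)"
  using three_colors[of d] by (elim disjE; simp)

text \<open>The nonzero elements of the ring are \<open>1\<close> and \<open>- 1\<close>, so this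
  compares signs. It converts equality of color steps along two trees into a comparison of
  parities.\<close>

lemma mult_sign3_eq_iff:
  fixes d e :: 3
  assumes "d \<noteq> 0" "e \<noteq> 0"
  shows "d * sign3 a = e * sign3 b \<longleftrightarrow> (a = b) = (d = e)"
  using assms three_colors[of d] three_colors[of e]
  by (elim disjE; simp add: sign3_def)

section \<open>Leaf numbering in the subtrees of a caret\<close>

lemma leaf_count_pos: "0 < leaf_count T"
  by (induction T) auto

lemma leaf_count_Caret: "leaf_count (Caret l r) = leaf_count l + leaf_count r"
  by simp

lemma nth_leaves_Caret:
  "k < leaf_count (Caret l r) \<Longrightarrow>
    leaves (Caret l r) ! k =
      (if k < leaf_count l then False # leaves l ! k else True # leaves r ! (k - leaf_count l))"
  by (auto simp: nth_append)

text \<open>Makes the span of a vertex nonempty; an empty interval \<open>{p + 1..q}\<close> would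
  not determine \<open>p\<close> and \<open>q\<close>.\<close>

lemma vertex_has_leaf: "v \<in> vertices T \<Longrightarrow> \<exists>k < leaf_count T. prefix v (leaves T ! k)"
proof (induction T arbitrary: v)
  case (Caret l r)
  show ?case
  proof (cases v)
    case Nil
    then show ?thesis using leaf_count_pos[of "Caret l r"] by (intro exI[of _ 0]) simp
  next
    case (Cons b w)
    show ?thesis
    proof (cases b)
      case True
      then have "w \<in> vertices r" using Caret.prems Cons by auto
      from Caret.IH(2)[OF this] obtain k where "k < leaf_count r" "prefix w (leaves r ! k)" by blast
      then show ?thesis using Cons True
        by (intro exI[of _ "leaf_count l + k"]) (auto simp: nth_append)
    next
      case False
      then have "w \<in> vertices l" using Caret.prems Cons by auto
      from Caret.IH(1)[OF this] obtain k where "k < leaf_count l" "prefix w (leaves l ! k)" by blast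
      then show ?thesis using Cons False
        by (intro exI[of _ k]) (auto simp: nth_append)
    qed
  qed
qed auto

lemma leaf_span_Nil: "leaf_span T [] p q \<longleftrightarrow> p = 0 \<and> q = leaf_count T"
proof -
  have "{i \<in> {1..leaf_count T}. prefix [] (leaves T ! (i - 1))} = {1..leaf_count T}" by auto
  then have "leaf_span T [] p q \<longleftrightarrow> {1..leaf_count T} = {p + 1..q}"
    unfolding leaf_span_def by (simp only:)
  then show ?thesis
    using leaf_count_pos[of T] unfolding Icc_eq_Icc by linarith
qed

lemma leaf_span_left:
  "leaf_span (Caret l r) (False # v) p q \<longleftrightarrow> leaf_span l v p q"
proof -
  have "{i \<in> {1..leaf_count (Caret l r)}. prefix (False # v) (leaves (Caret l r) ! (i - 1))}
      = {i \<in> {1..leaf_count l}. prefix v (leaves l ! (i - 1))}"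
    by (auto simp del: leaves.simps simp: leaf_count_Caret nth_leaves_Caret split: if_splits)
  then show ?thesis by (simp add: leaf_span_def)
qed

text \<open>The leaves of \<open>l\<close> shift all numbers by \<open>leaf_count l\<close>. Since
  \<open>v\<close> is a vertex its span is nonempty, and this forces both endpoints to be at least
  the offset.\<close>

lemma leaf_span_right:
  assumes "v \<in> vertices r"
  shows "leaf_span (Caret l r) (True # v) p q \<longleftrightarrow>
    (\<exists>p' q'. p = leaf_count l + p' \<and> q = leaf_count l + q' \<and> leaf_span r v p' q')"
proof -
  define X where "X = {i \<in> {1..leaf_count r}. prefix v (leaves r ! (i - 1))}"
  have shifted: "{i \<in> {1..leaf_count (Caret l r)}. prefix (True # v) (leaves (Caret l r) ! (i - 1))}
      = (+) (leaf_count l) ` X" (is "?A = _")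
  proof (intro subset_antisym subsetI)
    fix i assume i: "i \<in> ?A"
    then have "\<not> i - 1 < leaf_count l"
      by (auto simp: nth_append split: if_splits)
    with i have "i - leaf_count l \<in> X" "i = leaf_count l + (i - leaf_count l)"
      by (auto simp: X_def nth_append diff_right_commute split: if_splits)
    then show "i \<in> (+) (leaf_count l) ` X" by blast
  qed (auto simp: X_def nth_append)
  obtain k where "k < leaf_count r" "prefix v (leaves r ! k)"
    using vertex_has_leaf[OF assms] by blast
  then have "Suc k \<in> X" by (auto simp: X_def)
  show ?thesis
  proof
    assume "leaf_span (Caret l r) (True # v) p q"
    then have X: "(+) (leaf_count l) ` X = {p + 1..q}"
      unfolding leaf_span_def shifted .
    with \<open>Suc k \<in> X\<close> have "p + 1 \<in> (+) (leaf_count l) ` X" "q \<in> (+) (leaf_count l) ` X"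
      by (metis X atLeastAtMost_iff imageI le_refl order.trans)+
    then have ge: "leaf_count l \<le> p" "leaf_count l \<le> q"
      by (auto simp: X_def)
    have "X = {p - leaf_count l + 1..q - leaf_count l}"
    proof (rule Set.set_eqI)
      fix i
      have "i \<in> X \<longleftrightarrow> leaf_count l + i \<in> (+) (leaf_count l) ` X" by auto
      also have "\<dots> \<longleftrightarrow> i \<in> {p - leaf_count l + 1..q - leaf_count l}"
        unfolding X using ge by auto
      finally show "i \<in> X \<longleftrightarrow> i \<in> {p - leaf_count l + 1..q - leaf_count l}" .
    qed
    with ge show "\<exists>p' q'. p = leaf_count l + p' \<and> q = leaf_count l + q' \<and> leaf_span r v p' q'"
      by (intro exI[of _ "p - leaf_count l"] exI[of _ "q - leaf_count l"])
         (auto simp: leaf_span_def X_def)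
  next
    assume "\<exists>p' q'. p = leaf_count l + p' \<and> q = leaf_count l + q' \<and> leaf_span r v p' q'"
    then obtain p' q' where *: "p = leaf_count l + p'" "q = leaf_count l + q'" "X = {p' + 1..q'}"
      by (auto simp: leaf_span_def X_def)
    show "leaf_span (Caret l r) (True # v) p q"
      unfolding leaf_span_def shifted * by simp
  qed
qed

section \<open>Color steps along the leaves of one tree\<close>

lemma properly_colors_Tip: "properly_colors c a Tip \<longleftrightarrow> c a \<noteq> c (Suc a)"
  by (simp add: properly_colors_def leaf_span_Nil)

text \<open>The root is the only vertex exempt in the planar case, so what is left are the strip
  conditions of the two subtrees, including their own roots.\<close>

lemma properly_colors_children:
  "(\<forall>v\<in>vertices (Caret l r) - {[]}. \<forall>p q. leaf_span (Caret l r) v p q \<longrightarrow> c (a + p) \<noteq> c (a + q))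
   \<longleftrightarrow> properly_colors c a l \<and> properly_colors c (a + leaf_count l) r"
proof -
  have "vertices (Caret l r) - {[]} = Cons False ` vertices l \<union> Cons True ` vertices r" by auto
  then show ?thesis
    by (auto simp: properly_colors_def leaf_span_left leaf_span_right ball_Un add.assoc; blast)
qed

lemma properly_colors_Caret:
  "properly_colors c a (Caret l r) \<longleftrightarrow>
     c a \<noteq> c (a + leaf_count (Caret l r)) \<and>
     properly_colors c a l \<and> properly_colors c (a + leaf_count l) r"
proof -
  have "vertices (Caret l r) = insert [] (vertices (Caret l r) - {[]})" by auto
  then have "properly_colors c a (Caret l r) \<longleftrightarrow>
      (\<forall>p q. leaf_span (Caret l r) [] p q \<longrightarrow> c (a + p) \<noteq> c (a + q)) \<and>
      (\<forall>v\<in>vertices (Caret l r) - {[]}. \<forall>p q. leaf_span (Caret l r) v p q \<longrightarrow> c (a + p) \<noteq> c (a + q))"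
    unfolding properly_colors_def by (metis Diff_iff insert_iff)
  then show ?thesis
    unfolding properly_colors_children by (simp add: leaf_span_Nil)
qed

lemma properly_colors_root: "properly_colors c a T \<Longrightarrow> c a \<noteq> c (a + leaf_count T)"
  by (cases T) (auto simp: properly_colors_Tip properly_colors_Caret)

text \<open>
  At a vertex whose edge separates the colors \<open>x\<close> and \<open>x + d\<close>, the region between the two children
  gets the third color \<open>x - d\<close>, so both child edges carry the color step \<open>- d\<close>.
\<close>

lemma properly_colors_steps:
  assumes "properly_colors c a T" "k < leaf_count T"
  shows "c (a + Suc k) - c (a + k) =
    (c (a + leaf_count T) - c a) * sign3 (even (length (leaves T ! k)))"
  using assms
proof (induction T arbitrary: a k)
  case Tip
  then show ?case by (simp add: sign3_def)
next
  case (Caret l r)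
  let ?n = "leaf_count l + leaf_count r"
  have l: "properly_colors c a l" and r: "properly_colors c (a + leaf_count l) r"
    and ne: "c a \<noteq> c (a + ?n)"
    using Caret.prems(1) by (simp_all add: properly_colors_Caret)
  note third = third_color[OF ne properly_colors_root[OF l]
      properly_colors_root[OF r, unfolded add.assoc]]
  show ?case
  proof (cases "k < leaf_count l")
    case True
    have "c (a + Suc k) - c (a + k) = - (c (a + ?n) - c a) * sign3 (even (length (leaves l ! k)))"
      using Caret.IH(1)[OF l True] unfolding third(1) .
    then show ?thesis
      using True by (simp add: nth_append sign3_not del: minus_diff_eq)
  next
    case False
    then obtain j where j: "k = leaf_count l + j" "j < leaf_count r"
      using Caret.prems(2) by (auto simp: not_less le_iff_add)
    have "c (a + leaf_count l + Suc j) - c (a + leaf_count l + j)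
        = - (c (a + ?n) - c a) * sign3 (even (length (leaves r ! j)))"
      using Caret.IH(2)[OF r j(2)] unfolding add.assoc third(2) .
    then show ?thesis
      using j by (simp add: nth_append sign3_not add.assoc del: minus_diff_eq)
  qed
qed

text \<open>Converse of \<open>properly_colors_steps\<close>. Both subtrees get the step
  \<open>- d\<close>, and \<open>- d - d = d\<close> modulo 3 is the step of the whole tree, so the
  root edge is properly colored because \<open>d\<close> is nonzero.\<close>

lemma properly_colors_of_steps:
  assumes "d \<noteq> 0"
    and "\<And>k. k < leaf_count T \<Longrightarrow>
      c (a + Suc k) - c (a + k) = d * sign3 (even (length (leaves T ! k)))"
  shows "properly_colors c a T \<and> c (a + leaf_count T) = c a + d"
  using assms
proof (induction T arbitrary: a d)
  case Tip
  then show ?case using Tip(2)[of 0]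
    by (auto simp: properly_colors_Tip sign3_def algebra_simps)
next
  case (Caret l r)
  have "c (a + Suc k) - c (a + k) = - d * sign3 (even (length (leaves l ! k)))"
    if "k < leaf_count l" for k
    using Caret.prems(2)[of k] that by (simp add: nth_append sign3_not)
  then have l: "properly_colors c a l \<and> c (a + leaf_count l) = c a + - d"
    using Caret.prems(1) by (intro Caret.IH(1)) auto
  have "c (a + leaf_count l + Suc k) - c (a + leaf_count l + k)
      = - d * sign3 (even (length (leaves r ! k)))"
    if "k < leaf_count r" for k
    using Caret.prems(2)[of "leaf_count l + k"] that by (simp add: nth_append sign3_not add.assoc)
  then have r: "properly_colors c (a + leaf_count l) r \<and>
      c (a + leaf_count l + leaf_count r) = c (a + leaf_count l) + - d"
    using Caret.prems(1) by (intro Caret.IH(2)) auto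
  have "c (a + leaf_count (Caret l r)) = c a + (- d - d)"
    using l r by (simp add: add.assoc)
  then have "c (a + leaf_count (Caret l r)) = c a + d"
    unfolding double_eq_minus .
  with l r Caret.prems(1) show ?case by (simp add: properly_colors_Caret)
qed

section \<open>Colorability of a diagram as a condition on paired leaves\<close>

definition same_depth_parities :: "bintree \<Rightarrow> bintree \<Rightarrow> bool" where
  "same_depth_parities S T \<longleftrightarrow>
     list_all2 (\<lambda>v w. even (length v) = even (length w)) (leaves S) (leaves T)"

text \<open>Both root edges separate \<open>R_0\<close> from \<open>R_n\<close>, so the two trees
  share one root step, and their color steps across a common leaf agree iff the depths have equal
  parity.\<close>

lemma strip_three_colorable_iff:
  assumes "tree_diagram S T"
  shows "strip_three_colorable S T \<longleftrightarrow> same_depth_parities S T"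
proof
  have n: "leaf_count S = leaf_count T" using assms by (simp add: tree_diagram_def)
  {
    assume "strip_three_colorable S T"
    then obtain c where S: "properly_colors c 0 S" and T: "properly_colors c 0 T"
      unfolding strip_three_colorable_def properly_colors_def by auto
    have d: "c (leaf_count S) - c 0 \<noteq> 0"
      using properly_colors_root[OF S] by auto
    show "same_depth_parities S T"
      unfolding same_depth_parities_def list_all2_conv_all_nth
      using properly_colors_steps[OF S] properly_colors_steps[OF T] n mult_sign3_eq_iff[OF d d]
      by auto
  }
  {
    assume "same_depth_parities S T"
    then have eq: "even (length (leaves S ! k)) = even (length (leaves T ! k))"
      if "k < leaf_count S" for k
      using that by (simp add: same_depth_parities_def list_all2_conv_all_nth)
    \<comment> \<open>Partial sums of the signs prescribed by \<open>S\<close> form a coloring with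
      root step \<open>1\<close>; equal parities make it serve \<open>T\<close> as well.\<close>
    define c where "c k = (\<Sum>j<k. sign3 (even (length (leaves S ! j))))" for k
    have "properly_colors c 0 S" "properly_colors c 0 T"
      using properly_colors_of_steps[of 1 S c 0] properly_colors_of_steps[of 1 T c 0] eq n
      by (auto simp: c_def)
    then show "strip_three_colorable S T"
      unfolding strip_three_colorable_def properly_colors_def by auto
  }
qed

text \<open>
  In a planar coloring the edges to the two children of the root carry opposite color steps, so the
  step across the edge of a vertex depends on its first digit as well as on its depth.
\<close>

definition planar_parity :: "bool list \<Rightarrow> bool" where
  "planar_parity v \<longleftrightarrow> even (length v) = hd v"

text \<open>The value \<open>e\<close> corresponds to whether the color steps across the edge of the
  left child of the root agree in the two trees. Words are required to be nonempty because
  \<open>hd []\<close> is unspecified.\<close>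

definition parity_shift :: "bool \<Rightarrow> bintree \<Rightarrow> bintree \<Rightarrow> bool" where
  "parity_shift e S T \<longleftrightarrow>
     list_all2 (\<lambda>v w. v \<noteq> [] \<and> w \<noteq> [] \<and> (planar_parity v = planar_parity w) = e)
       (leaves S) (leaves T)"

text \<open>Below the left child planar parity is the depth parity within that subtree, below the
  right child its negation. The negation absorbs the opposite step forced there by the common color
  of \<open>R_0\<close> and \<open>R_n\<close>.\<close>

lemma planar_steps:
  assumes "c 0 = c (leaf_count (Caret l r))"
  shows "(\<forall>v\<in>vertices (Caret l r) - {[]}. \<forall>p q. leaf_span (Caret l r) v p q \<longrightarrow> c p \<noteq> c q) \<longleftrightarrow>
    (\<exists>d\<noteq>0. \<forall>k<leaf_count (Caret l r).
       c (Suc k) - c k = d * sign3 (planar_parity (leaves (Caret l r) ! k)))"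
    (is "?A \<longleftrightarrow> ?B")
proof
  have A: "?A \<longleftrightarrow> properly_colors c 0 l \<and> properly_colors c (leaf_count l) r"
    using properly_colors_children[of l r c 0] by simp
  {
    assume ?A
    then have l: "properly_colors c 0 l" and r: "properly_colors c (leaf_count l) r"
      unfolding A by auto
    define d where "d = c (leaf_count l) - c 0"
    have "d \<noteq> 0" using properly_colors_root[OF l] by (auto simp: d_def)
    moreover have "c (Suc k) - c k = d * sign3 (planar_parity (leaves (Caret l r) ! k))"
      if k: "k < leaf_count (Caret l r)" for k
    proof (cases "k < leaf_count l")
      case True
      then show ?thesis
        using properly_colors_steps[OF l, of k]
        by (simp add: nth_append d_def planar_parity_def)
    next
      case False
      then obtain j where j: "k = leaf_count l + j" "j < leaf_count r"
        using k by (auto simp: not_less le_iff_add)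
      then have "c (Suc k) - c k
          = (c (leaf_count l + leaf_count r) - c (leaf_count l)) * sign3 (even (length (leaves r ! j)))"
        using properly_colors_steps[OF r, of j] by simp
      also have "c (leaf_count l + leaf_count r) - c (leaf_count l) = - d"
        using assms by (simp add: d_def)
      finally show ?thesis
        using j by (simp add: nth_append planar_parity_def sign3_not)
    qed
    ultimately show ?B by blast
  }
  {
    assume ?B
    then obtain d where d: "d \<noteq> 0" and
      step: "\<And>k. k < leaf_count (Caret l r) \<Longrightarrow>
        c (Suc k) - c k = d * sign3 (planar_parity (leaves (Caret l r) ! k))" by blast
    have "c (0 + Suc k) - c (0 + k) = d * sign3 (even (length (leaves l ! k)))"
      if "k < leaf_count l" for k
      using step[of k] that by (simp add: nth_append planar_parity_def)
    moreover have "c (leaf_count l + Suc k) - c (leaf_count l + k)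
        = - d * sign3 (even (length (leaves r ! k)))"
      if "k < leaf_count r" for k
      using step[of "leaf_count l + k"] that
      by (simp add: nth_append planar_parity_def sign3_not)
    ultimately show ?A
      unfolding A using d
      using properly_colors_of_steps[of d l c 0] properly_colors_of_steps[of "- d" r c "leaf_count l"]
      by auto
  }
qed

lemma sum_lessThan_add:
  fixes f :: "nat \<Rightarrow> 'a :: comm_monoid_add"
  shows "(\<Sum>k<m + n. f k) = (\<Sum>k<m. f k) + (\<Sum>k<n. f (m + k))"
  by (induction n) (simp_all add: add.assoc)

text \<open>Needed for the partial-sum coloring to return to its initial color, as
  \<open>R_0 = R_n\<close> demands. Each subtree has total step \<open>1\<close>, and the right one
  enters with the opposite sign.\<close>

lemma planar_parity_sum: "(\<Sum>k<leaf_count (Caret l r). sign3 (planar_parity (leaves (Caret l r) ! k))) = 0"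
proof -
  have total: "(\<Sum>k<leaf_count T. sign3 (even (length (leaves T ! k)))) = 1" for T
    using properly_colors_of_steps[of 1 T "\<lambda>k. \<Sum>j<k. sign3 (even (length (leaves T ! j)))" 0]
    by simp
  have "(\<Sum>k<leaf_count (Caret l r). sign3 (planar_parity (leaves (Caret l r) ! k)))
      = (\<Sum>k<leaf_count l. sign3 (even (length (leaves l ! k))))
        + (\<Sum>k<leaf_count r. - sign3 (even (length (leaves r ! k))))"
    unfolding leaves.simps length_append length_map
    by (subst sum_lessThan_add) (simp add: nth_append planar_parity_def sign3_not)
  then show ?thesis by (simp add: total sum_negf)
qed

text \<open>No root edge ties the two trees together in the planar case, so their steps
  \<open>d\<close> and \<open>d'\<close> may differ by a sign; this is the freedom recorded in
  \<open>e\<close>.\<close>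

lemma planar_three_colorable_iff:
  assumes "tree_diagram (Caret l r) (Caret l' r')"
  shows "planar_three_colorable (Caret l r) (Caret l' r') \<longleftrightarrow>
    (\<exists>e. parity_shift e (Caret l r) (Caret l' r'))"
    (is "planar_three_colorable ?S ?T \<longleftrightarrow> _")
proof
  have n: "leaf_count ?S = leaf_count ?T" using assms by (simp add: tree_diagram_def)
  have nonempty: "v \<noteq> []" if "v \<in> set (leaves (Caret a b))" for a b v
    using that by auto
  {
    assume "planar_three_colorable ?S ?T"
    then obtain c :: "nat \<Rightarrow> 3" where c: "c 0 = c (leaf_count ?S)"
      and col: "\<forall>T\<in>{?S, ?T}. \<forall>v\<in>vertices T - {[]}. \<forall>p q. leaf_span T v p q \<longrightarrow> c p \<noteq> c q"
      unfolding planar_three_colorable_def by blast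
    obtain d where d: "d \<noteq> 0" and
      S: "\<forall>k<leaf_count ?S. c (Suc k) - c k = d * sign3 (planar_parity (leaves ?S ! k))"
      using bspec[OF col insertI1] unfolding planar_steps[OF c] by blast
    obtain d' where d': "d' \<noteq> 0" and
      T: "\<forall>k<leaf_count ?T. c (Suc k) - c k = d' * sign3 (planar_parity (leaves ?T ! k))"
      using bspec[OF col insertI2[OF singletonI]] unfolding planar_steps[OF c[unfolded n]] by blast
    have "(planar_parity (leaves ?S ! k) = planar_parity (leaves ?T ! k)) = (d = d')"
      if k: "k < leaf_count ?S" for k
    proof -
      have "d * sign3 (planar_parity (leaves ?S ! k)) = d' * sign3 (planar_parity (leaves ?T ! k))"
        using S[rule_format, OF k] T[rule_format, OF k[unfolded n]] by (rule trans[OF sym])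
      then show ?thesis unfolding mult_sign3_eq_iff[OF d d'] .
    qed
    then have "parity_shift (d = d') ?S ?T"
      unfolding parity_shift_def list_all2_conv_all_nth
      using n nonempty[OF nth_mem] by (simp del: leaves.simps)
    then show "\<exists>e. parity_shift e ?S ?T" ..
  }
  {
    assume "\<exists>e. parity_shift e ?S ?T"
    then obtain e where e: "\<And>k. k < leaf_count ?S \<Longrightarrow>
        (planar_parity (leaves ?S ! k) = planar_parity (leaves ?T ! k)) = e"
      unfolding parity_shift_def list_all2_conv_all_nth by blast
    define c where "c k = (\<Sum>j<k. sign3 (planar_parity (leaves ?S ! j)))" for k
    have c: "c 0 = c (leaf_count ?S)" unfolding c_def planar_parity_sum by simp
    \<comment> \<open>Coloring by the signs of \<open>S\<close> uses the step \<open>1\<close>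
      there, and \<open>T\<close> then sees the step \<open>sign3 e\<close>.\<close>
    have one: "(1 :: 3) \<noteq> 0" "sign3 e \<noteq> 0" "(1 = sign3 e) = e"
      by (auto simp: sign3_def)
    have step: "c (Suc k) - c k = 1 * sign3 (planar_parity (leaves ?S ! k))" for k
      by (simp add: c_def del: leaves.simps)
    have "c (Suc k) - c k = sign3 e * sign3 (planar_parity (leaves ?T ! k))"
      if "k < leaf_count ?T" for k
      unfolding step mult_sign3_eq_iff[OF one(1,2)] one(3) by (rule e) (simp only: n that)
    then have T: "\<forall>v\<in>vertices ?T - {[]}. \<forall>p q. leaf_span ?T v p q \<longrightarrow> c p \<noteq> c q"
      unfolding planar_steps[OF c[unfolded n]] using one(2) by blast
    have S: "\<forall>v\<in>vertices ?S - {[]}. \<forall>p q. leaf_span ?S v p q \<longrightarrow> c p \<noteq> c q"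
      unfolding planar_steps[OF c] using one(1) step by blast
    show "planar_three_colorable ?S ?T"
      unfolding planar_three_colorable_def
    proof (intro exI[of _ c] conjI ballI)
      fix T v assume "T \<in> {?S, ?T}" "v \<in> vertices T - {[]}"
      then show "\<forall>p q. leaf_span T v p q \<longrightarrow> c p \<noteq> c q" using S T by (elim insertE emptyE) simp_all
    qed (rule c)
  }
qed

section \<open>Maps represented by tree diagrams\<close>

primrec word_value :: "bool list \<Rightarrow> real" where
  "word_value [] = 0"
| "word_value (b # v) = (of_bool b + word_value v) / 2"

lemma binary_value_shift:
  "binary_value (v @- \<gamma>) = word_value v + binary_value \<gamma> / 2 ^ length v"
  by (induction v) (simp_all add: binary_value_SCons add_divide_distrib)

lemma binary_expansion_exists:
  assumes "t \<in> {0..1}"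
  obtains \<gamma> where "binary_value \<gamma> = t"
proof
  \<comment> \<open>\<open>D\<close> is the doubling map, and each digit tells in which half the
    current point lies. The point \<open>1\<close> is fixed, so it gets the expansion with all
    digits 1.\<close>
  define D :: "real \<Rightarrow> real" where "D x = (if x < 1/2 then 2 * x else 2 * x - 1)" for x
  define digits where "digits x = smap (\<lambda>y. y \<ge> 1/2) (siterate D x)" for x
  have digits: "digits x = (x \<ge> 1/2) ## digits (D x)" for x
    unfolding digits_def by (subst siterate.code) simp
  \<comment> \<open>Dropping one digit doubles the error, so an error of at most 1 everywhere is at
    most \<open>1 / 2 ^ n\<close> for every \<open>n\<close>, hence zero.\<close>
  have bound: "\<bar>binary_value (digits x) - x\<bar> \<le> 1 / 2 ^ n" if "x \<in> {0..1}" for x n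
    using that
  proof (induction n arbitrary: x)
    case 0
    then show ?case using binary_value_bounds[of "digits x"] by auto
  next
    case (Suc n)
    have "\<bar>binary_value (digits (D x)) - D x\<bar> \<le> 1 / 2 ^ n"
      using Suc.prems by (intro Suc.IH) (auto simp: D_def)
    then have "\<bar>(binary_value (digits (D x)) - D x) / 2\<bar> \<le> (1 / 2 ^ n) / 2"
      unfolding abs_divide abs_numeral by (rule divide_right_mono) simp
    moreover have "binary_value (digits x) - x = (binary_value (digits (D x)) - D x) / 2"
      by (subst digits) (auto simp: binary_value_SCons D_def field_simps)
    ultimately show ?case by simp
  qed
  have "(\<lambda>n. 1 / 2 ^ n :: real) \<longlonglongrightarrow> 0"
    by (rule LIMSEQ_divide_realpow_zero) simp
  then have "\<bar>binary_value (digits t) - t\<bar> \<le> 0"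
    using bound[OF assms] by (intro LIMSEQ_le_const) auto
  then show "binary_value (digits t) = t" by simp
qed

section \<open>Subdivision of the unit interval into leaf intervals\<close>

definition leaf_width :: "bintree \<Rightarrow> nat \<Rightarrow> real" where
  "leaf_width T k = 1 / 2 ^ length (leaves T ! k)"

text \<open>Endpoints of the leaf intervals. Summing widths also covers the right end at index
  \<open>leaf_count T\<close>, which is not the left endpoint of any leaf.\<close>

definition grid :: "bintree \<Rightarrow> nat \<Rightarrow> real" where
  "grid T k = (\<Sum>j<k. leaf_width T j)"

lemma grid_0 [simp]: "grid T 0 = 0"
  by (simp add: grid_def)

lemma grid_Suc: "grid T (Suc k) = grid T k + leaf_width T k"
  by (simp add: grid_def)

lemma leaf_width_pos: "0 < leaf_width T k"
  by (simp add: leaf_width_def)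

lemma grid_mono: "i \<le> j \<Longrightarrow> grid T i \<le> grid T j"
  unfolding grid_def by (intro sum_mono2) (auto simp: less_imp_le[OF leaf_width_pos])

lemma grid_Caret_left: "k \<le> leaf_count l \<Longrightarrow> grid (Caret l r) k = grid l k / 2"
  unfolding grid_def sum_divide_distrib
  by (intro sum.cong) (auto simp: leaf_width_def nth_append)

lemma grid_Caret_right:
  assumes "k \<le> leaf_count r"
  shows "grid (Caret l r) (leaf_count l + k) = grid l (leaf_count l) / 2 + grid r k / 2"
proof -
  have "grid (Caret l r) (leaf_count l + k)
      = grid (Caret l r) (leaf_count l) + (\<Sum>j<k. leaf_width (Caret l r) (leaf_count l + j))"
    unfolding grid_def by (rule sum_lessThan_add)
  also have "(\<Sum>j<k. leaf_width (Caret l r) (leaf_count l + j)) = grid r k / 2"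
    using assms unfolding grid_def sum_divide_distrib
    by (intro sum.cong) (auto simp: leaf_width_def nth_append)
  finally show ?thesis by (simp add: grid_Caret_left)
qed

lemma grid_leaf_count [simp]: "grid T (leaf_count T) = 1"
proof (induction T)
  case Tip
  then show ?case by (simp add: grid_def leaf_width_def)
next
  case (Caret l r)
  then show ?case using grid_Caret_right[of "leaf_count r" r l] by simp
qed

lemma grid_eq_word_value: "k < leaf_count T \<Longrightarrow> grid T k = word_value (leaves T ! k)"
proof (induction T arbitrary: k)
  case (Caret l r)
  show ?case
  proof (cases "k < leaf_count l")
    case True
    then show ?thesis using Caret.IH(1)[OF True] by (simp add: grid_Caret_left nth_append)
  next
    case False
    then obtain j where j: "k = leaf_count l + j" "j < leaf_count r"
      using Caret.prems by (auto simp: not_less le_iff_add)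
    then show ?thesis
      using Caret.IH(2)[OF j(2)] by (simp add: grid_Caret_right nth_append add_divide_distrib)
  qed
qed simp

lemma binary_value_leaf:
  assumes "k < leaf_count T"
  shows "binary_value (leaves T ! k @- \<gamma>) = grid T k + leaf_width T k * binary_value \<gamma>"
  by (simp add: binary_value_shift grid_eq_word_value[OF assms] leaf_width_def)

lemma exists_step_interval:
  fixes s :: "nat \<Rightarrow> real"
  assumes "0 < n" "s 0 \<le> a" "a \<le> b" "b \<le> s n"
    and "\<And>k. k \<le> n \<Longrightarrow> \<not> (a < s k \<and> s k < b)"
  shows "\<exists>k<n. s k \<le> a \<and> b \<le> s (Suc k)"
  using assms
proof (induction n)
  case (Suc m)
  show ?case
  proof (cases "s m \<le> a")
    case True
    then show ?thesis using Suc.prems by blast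
  next
    case False
    then have "b \<le> s m" using Suc.prems(5)[of m] by simp
    moreover have "0 < m" using False Suc.prems(2) by (cases m) auto
    ultimately have "\<exists>k<m. s k \<le> a \<and> b \<le> s (Suc k)"
      using Suc.prems by (intro Suc.IH) auto
    then show ?thesis using less_SucI by blast
  qed
qed simp

lemma leaf_interval_exists:
  assumes "t \<in> {0..1}"
  obtains k where "k < leaf_count T" "grid T k \<le> t" "t \<le> grid T (Suc k)"
  using exists_step_interval[of "leaf_count T" "grid T" t t] assms leaf_count_pos by auto

lemma leaf_expansion_exists:
  assumes "t \<in> {0..1}"
  obtains k \<gamma> where "k < leaf_count T" "t = binary_value (leaves T ! k @- \<gamma>)"
proof -
  obtain k where k: "k < leaf_count T" "grid T k \<le> t" "t \<le> grid T (Suc k)"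
    using leaf_interval_exists[OF assms] .
  have pos: "0 < leaf_width T k" by (rule leaf_width_pos)
  have "(t - grid T k) / leaf_width T k \<in> {0..1}"
    using k pos by (simp add: grid_Suc field_simps)
  then obtain \<gamma> where "binary_value \<gamma> = (t - grid T k) / leaf_width T k"
    by (rule binary_expansion_exists)
  then have "t = binary_value (leaves T ! k @- \<gamma>)"
    using pos by (simp add: binary_value_leaf[OF k(1)])
  with k(1) show ?thesis by (rule that)
qed

section \<open>Represented maps as elements of \<open>F\<close>\<close>

definition prefix_map :: "(real \<Rightarrow> real) \<Rightarrow> bool list \<Rightarrow> bool list \<Rightarrow> bool" where
  "prefix_map f v w \<longleftrightarrow> (\<forall>\<gamma>. f (binary_value (v @- \<gamma>)) = binary_value (w @- \<gamma>))"

lemma represents_iff: "represents S T f \<longleftrightarrow> list_all2 (prefix_map f) (leaves S) (leaves T)"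
  by (auto simp: represents_def tree_diagram_def list_all2_conv_all_nth prefix_map_def)

lemma represents_unique:
  assumes "represents S T f" "represents S T g" "f \<in> extensional {0..1}" "g \<in> extensional {0..1}"
  shows "f = g"
proof (rule extensionalityI[OF assms(3,4)])
  fix t :: real assume "t \<in> {0..1}"
  then obtain k \<gamma> where "k < leaf_count S" "t = binary_value (leaves S ! k @- \<gamma>)"
    by (rule leaf_expansion_exists)
  with assms(1,2) show "f t = g t" by (simp add: represents_def)
qed

text \<open>
  The \<open>j\<close>-th summand climbs from 0 to the width of the \<open>j\<close>-th leaf of \<open>T\<close> while \<open>t\<close> crosses the
  \<open>j\<close>-th leaf of \<open>S\<close>, which makes continuity evident.
\<close>

definition tree_map :: "bintree \<Rightarrow> bintree \<Rightarrow> real \<Rightarrow> real" where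
  "tree_map S T = (\<lambda>t\<in>{0..1}. \<Sum>j<leaf_count S.
     leaf_width T j * max 0 (min 1 ((t - grid S j) / leaf_width S j)))"

text \<open>Summands left of the leaf have reached their full width, those right of it are still
  zero, and only the \<open>k\<close>-th one varies.\<close>

lemma tree_map_on_leaf:
  assumes "k < leaf_count S" "grid S k \<le> t" "t \<le> grid S (Suc k)"
  shows "tree_map S T t = grid T k + leaf_width T k * ((t - grid S k) / leaf_width S k)"
proof -
  let ?h = "\<lambda>j. leaf_width T j * max 0 (min 1 ((t - grid S j) / leaf_width S j))"
  have "0 \<le> grid S k" "grid S (Suc k) \<le> 1"
    using grid_mono[of 0 k S] grid_mono[of "Suc k" "leaf_count S" S] assms(1) by auto
  then have t: "t \<in> {0..1}" using assms by auto
  have before: "?h j = leaf_width T j" if "j < k" for j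
  proof -
    have "grid S j + leaf_width S j \<le> t"
      using grid_mono[of "Suc j" k S] that assms(2) by (simp add: grid_Suc)
    then have "1 \<le> (t - grid S j) / leaf_width S j"
      using leaf_width_pos[of S j] by (simp add: field_simps)
    then show ?thesis by simp
  qed
  have after: "?h j = 0" if "j \<ge> Suc k" for j
  proof -
    have "t \<le> grid S j" using grid_mono[OF that, of S] assms(3) by simp
    then have "(t - grid S j) / leaf_width S j \<le> 0"
      using leaf_width_pos[of S j] by (simp add: divide_le_0_iff)
    then show ?thesis by simp
  qed
  have "?h k = leaf_width T k * ((t - grid S k) / leaf_width S k)"
    using assms(2,3) leaf_width_pos[of S k] by (simp add: grid_Suc field_simps)
  moreover have "(\<Sum>j<leaf_count S. ?h j) = (\<Sum>j<Suc k. ?h j)"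
    using assms(1) after by (intro sum.mono_neutral_right) auto
  moreover have "(\<Sum>j<k. ?h j) = (\<Sum>j<k. leaf_width T j)"
    by (intro sum.cong refl) (simp only: lessThan_iff before)
  ultimately have "(\<Sum>j<leaf_count S. ?h j)
      = (\<Sum>j<k. leaf_width T j) + leaf_width T k * ((t - grid S k) / leaf_width S k)"
    by (simp only: sum.lessThan_Suc)
  then show ?thesis
    using t by (simp add: tree_map_def flip: grid_def)
qed

lemma tree_map_extensional: "tree_map S T \<in> extensional {0..1}"
  by (simp add: tree_map_def)

lemma represents_tree_map:
  assumes "tree_diagram S T"
  shows "represents S T (tree_map S T)"
  unfolding represents_def
proof (intro conjI allI impI assms)
  fix k \<gamma> assume k: "k < leaf_count S"
  let ?t = "binary_value (leaves S ! k @- \<gamma>)"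
  have "grid S k \<le> ?t" "?t \<le> grid S (Suc k)"
    using binary_value_bounds[of \<gamma>] leaf_width_pos[of S k]
    by (auto simp: binary_value_leaf[OF k] grid_Suc)
  from tree_map_on_leaf[OF k this]
  show "tree_map S T ?t = binary_value (leaves T ! k @- \<gamma>)"
    using k assms leaf_width_pos[of S k] by (simp add: binary_value_leaf tree_diagram_def)
qed

lemma represents_eq_tree_map:
  assumes "represents S T f" "f \<in> extensional {0..1}"
  shows "f = tree_map S T"
proof -
  have "tree_diagram S T" using assms(1) by (simp add: represents_def)
  then show ?thesis
    using assms represents_unique represents_tree_map tree_map_extensional by blast
qed

lemma represents_maps_to:
  assumes "represents S T f" "t \<in> {0..1}"
  shows "f t \<in> {0..1}"
proof -
  obtain k \<gamma> where "k < leaf_count S" "t = binary_value (leaves S ! k @- \<gamma>)"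
    using leaf_expansion_exists[OF assms(2)] .
  then show ?thesis using assms(1) binary_value_bounds by (simp add: represents_def)
qed

lemma represents_0:
  assumes "represents S T f" "f \<in> extensional {0..1}"
  shows "f 0 = 0"
  using tree_map_on_leaf[of 0 S 0 T] leaf_count_pos[of S] less_imp_le[OF leaf_width_pos]
  by (simp add: represents_eq_tree_map[OF assms] grid_Suc)

lemma represents_1:
  assumes "represents S T f" "f \<in> extensional {0..1}"
  shows "f 1 = 1"
proof -
  obtain m where m: "leaf_count S = Suc m" "leaf_count T = Suc m"
    using assms(1) leaf_count_pos[of S] by (cases "leaf_count S") (auto simp: represents_def tree_diagram_def)
  have S: "grid S m + leaf_width S m = 1" and T: "grid T m + leaf_width T m = 1"
    using grid_leaf_count[of S] grid_leaf_count[of T] m by (simp_all add: grid_Suc)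
  then have "(1 - grid S m) / leaf_width S m = 1"
    using leaf_width_pos[of S m] by (simp add: field_simps)
  moreover have "tree_map S T 1 = grid T m + leaf_width T m * ((1 - grid S m) / leaf_width S m)"
    using m S leaf_width_pos[of S m] by (intro tree_map_on_leaf) (simp_all add: grid_Suc)
  ultimately show ?thesis
    using T by (simp add: represents_eq_tree_map[OF assms])
qed

lemma continuous_tree_map: "continuous_on {0..1} (tree_map S T)"
proof -
  have "continuous_on {0..1} (\<lambda>t. \<Sum>j<leaf_count S.
     leaf_width T j * max 0 (min 1 ((t - grid S j) / leaf_width S j)))"
    using leaf_width_pos[of S] by (intro continuous_intros) (auto simp: less_imp_neq[THEN not_sym])
  then show ?thesis
    by (rule continuous_on_eq) (simp add: tree_map_def)
qed

lemma dyadic_grid: "grid T k \<in> dyadic_rationals"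
proof (induction k)
  case 0
  have "(0 :: real) = of_int 0 / 2 ^ 0" by simp
  then show ?case unfolding dyadic_rationals_def grid_0 by blast
next
  case (Suc k)
  then obtain a :: int and n :: nat where "grid T k = of_int a / 2 ^ n"
    by (auto simp: dyadic_rationals_def)
  then have "grid T (Suc k) = of_int (a * 2 ^ length (leaves T ! k) + 2 ^ n) / 2 ^ (n + length (leaves T ! k))"
    by (simp add: grid_Suc leaf_width_def field_simps power_add)
  then show ?case unfolding dyadic_rationals_def by blast
qed

lemma dyadic_piecewise_linear_tree_map: "dyadic_piecewise_linear (tree_map S T)"
  unfolding dyadic_piecewise_linear_def
proof (intro exI[of _ "grid S ` {..leaf_count S}"] conjI allI impI)
  show "grid S ` {..leaf_count S} \<subseteq> dyadic_rationals" using dyadic_grid by auto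
  fix a b :: real
  assume ab: "0 \<le> a \<and> a < b \<and> b \<le> 1 \<and> {a<..<b} \<inter> grid S ` {..leaf_count S} = {}"
  then have "\<not> (a < grid S k \<and> grid S k < b)" if "k \<le> leaf_count S" for k
    using that by auto
  then obtain k where k: "k < leaf_count S" "grid S k \<le> a" "b \<le> grid S (Suc k)"
    using exists_step_interval[of "leaf_count S" "grid S" a b] ab leaf_count_pos by auto
  define e where "e = int (length (leaves S ! k)) - int (length (leaves T ! k))"
  have slope: "leaf_width T k / leaf_width S k = 2 powi e"
    by (simp add: leaf_width_def e_def power_int_diff)
  have affine: "tree_map S T t = grid T k + 2 powi e * (t - grid S k)" if "t \<in> {a..b}" for t
    using tree_map_on_leaf[OF k(1), of t T] that k slope by (simp flip: slope)
  have "tree_map S T t = tree_map S T a + 2 powi e * (t - a)" if "t \<in> {a..b}" for t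
    using affine[OF that] affine[of a] ab by (simp add: algebra_simps)
  then show "\<exists>k. \<forall>t\<in>{a..b}. tree_map S T t = tree_map S T a + 2 powi k * (t - a)" by blast
qed auto

lemma represents_inverse:
  assumes "represents S T f" "represents T S g" "t \<in> {0..1}"
  shows "g (f t) = t"
proof -
  obtain k \<gamma> where "k < leaf_count S" "t = binary_value (leaves S ! k @- \<gamma>)"
    using leaf_expansion_exists[OF assms(3)] .
  then show ?thesis using assms(1,2) by (simp add: represents_def tree_diagram_def)
qed

lemma thompson_F_simps [simp]:
  "carrier thompson_F = {f \<in> extensional {0..1}.
     (\<exists>g. homeomorphism {0..1} {0..1} f g) \<and> dyadic_piecewise_linear f}"
  "f \<otimes>\<^bsub>thompson_F\<^esub> g = compose {0..1} g f"
  "\<one>\<^bsub>thompson_F\<^esub> = (\<lambda>t\<in>{0..1}. t)"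
  by (simp_all add: thompson_F_def)

lemma tree_diagram_sym: "tree_diagram S T \<Longrightarrow> tree_diagram T S"
  by (simp add: tree_diagram_def)

text \<open>The inverse homeomorphism is the tree map of the reversed diagram, so membership in
  \<open>F\<close> can be read off a diagram.\<close>

lemma represented_in_carrier:
  assumes "represents S T f" "f \<in> extensional {0..1}"
  shows "f \<in> carrier thompson_F"
proof -
  have "tree_diagram S T" using assms(1) by (simp add: represents_def)
  then have g: "represents T S (tree_map T S)"
    by (intro represents_tree_map) (rule tree_diagram_sym)
  have "homeomorphism {0..1} {0..1} f (tree_map T S)"
  proof (rule homeomorphismI)
    show "continuous_on {0..1} f" "continuous_on {0..1} (tree_map T S)"
      unfolding represents_eq_tree_map[OF assms] by (rule continuous_tree_map)+
  qed (use assms(1) g in \<open>auto dest: represents_inverse represents_maps_to\<close>)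
  then show ?thesis
    using assms represents_eq_tree_map[OF assms] dyadic_piecewise_linear_tree_map by auto
qed

lemma represents_mult:
  assumes "represents S T f" "represents T U g"
  shows "represents S U (f \<otimes>\<^bsub>thompson_F\<^esub> g)"
  using assms binary_value_bounds
  by (simp add: represents_def tree_diagram_def compose_def)

text \<open>The inverse is a definite description, so uniqueness has to be proved: evaluating an
  inverse \<open>y\<close> at \<open>t = f (g t)\<close> gives \<open>g t\<close>.\<close>

lemma m_inv_eq_represented:
  assumes f: "represents S T f" "f \<in> extensional {0..1}"
    and g: "represents T S g" "g \<in> extensional {0..1}"
  shows "inv\<^bsub>thompson_F\<^esub> f = g"
  unfolding m_inv_def
proof (rule the_equality)
  have "compose {0..1} f' g' = (\<lambda>t\<in>{0..1}. t)"
    if "represents A B g'" "represents B A f'" for A B f' g'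
    using represents_inverse[OF that] by (auto simp: compose_def fun_eq_iff)
  then show "g \<in> carrier thompson_F \<and> f \<otimes>\<^bsub>thompson_F\<^esub> g = \<one>\<^bsub>thompson_F\<^esub> \<and>
      g \<otimes>\<^bsub>thompson_F\<^esub> f = \<one>\<^bsub>thompson_F\<^esub>"
    using f g represented_in_carrier[OF g] by simp
  fix y
  assume y: "y \<in> carrier thompson_F \<and> f \<otimes>\<^bsub>thompson_F\<^esub> y = \<one>\<^bsub>thompson_F\<^esub> \<and>
      y \<otimes>\<^bsub>thompson_F\<^esub> f = \<one>\<^bsub>thompson_F\<^esub>"
  show "y = g"
  proof (rule extensionalityI)
    show "y \<in> extensional {0..1}" using y by simp
    fix t :: real assume t: "t \<in> {0..1}"
    have "y (f (g t)) = g t"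
    proof -
      have "compose {0..1} y f (g t) = (\<lambda>t\<in>{0..1}. t) (g t)"
        using y by simp
      then show ?thesis
        using represents_maps_to[OF g(1) t] by (simp add: compose_def)
    qed
    then show "y t = g t" using represents_inverse[OF g(1) f(1) t] by simp
  qed (use g in simp)
qed

section \<open>Grafting and common refinements\<close>

primrec graft :: "bintree \<Rightarrow> bintree list \<Rightarrow> bintree" where
  "graft Tip ts = hd ts"
| "graft (Caret l r) ts = Caret (graft l (take (leaf_count l) ts)) (graft r (drop (leaf_count l) ts))"

lemma leaves_graft:
  "length ts = leaf_count T \<Longrightarrow>
    leaves (graft T ts) = concat (map2 (\<lambda>v t. map ((@) v) (leaves t)) (leaves T) ts)"
proof (induction T arbitrary: ts)
  case Tip
  then show ?case by (cases ts) (auto intro: map_idI[symmetric])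
next
  case (Caret l r)
  define us vs where "us = take (leaf_count l) ts" and "vs = drop (leaf_count l) ts"
  have ts: "ts = us @ vs" and len: "length us = leaf_count l" "length vs = leaf_count r"
    using Caret.prems by (auto simp: us_def vs_def)
  have cons_append: "(@) (b # v) = (\<lambda>w. b # v @ w)" for b :: bool and v by auto
  have cons: "concat (map2 (\<lambda>v t. map ((@) v) (leaves t)) (map (Cons b) xs) ys)
      = map (Cons b) (concat (map2 (\<lambda>v t. map ((@) v) (leaves t)) xs ys))" for b xs ys
    by (simp add: zip_map1 map_concat comp_def case_prod_beta cons_append)
  have "leaves (graft (Caret l r) ts)
      = map (Cons False) (leaves (graft l us)) @ map (Cons True) (leaves (graft r vs))"
    by (simp add: us_def vs_def)
  also have "\<dots> = concat (map2 (\<lambda>v t. map ((@) v) (leaves t)) (leaves (Caret l r)) (us @ vs))"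
    unfolding Caret.IH(1)[OF len(1)] Caret.IH(2)[OF len(2)]
    by (simp only: leaves.simps zip_append length_map len map_append concat_append cons)
  finally show ?case unfolding ts .
qed

lemma graft_Tips: "graft T (replicate (leaf_count T) Tip) = T"
  by (induction T) auto

text \<open>Gives the two factors of a product a common middle tree. Both trees are descended
  simultaneously; where one ends, the rest of the other is grafted onto it.\<close>

lemma common_refinement:
  obtains ts us where "length ts = leaf_count T" "length us = leaf_count U" "graft T ts = graft U us"
proof -
  have "\<exists>ts us. length ts = leaf_count T \<and> length us = leaf_count U \<and> graft T ts = graft U us"
  proof (induction T arbitrary: U)
    case Tip
    show ?case
      by (intro exI[of _ "[U]"] exI[of _ "replicate (leaf_count U) Tip"]) (simp add: graft_Tips)
  next
    case (Caret l r)
    show ?case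
    proof (cases U)
      case Tip
      show ?thesis
        unfolding Tip
        by (intro exI[of _ "replicate (leaf_count (Caret l r)) Tip"] exI[of _ "[Caret l r]"])
           (simp only: graft_Tips length_replicate, simp)
    next
      case (Caret l' r')
      obtain ts us where 1: "length ts = leaf_count l" "length us = leaf_count l'" "graft l ts = graft l' us"
        using Caret.IH(1) by blast
      obtain ts' us' where 2: "length ts' = leaf_count r" "length us' = leaf_count r'" "graft r ts' = graft r' us'"
        using Caret.IH(2) by blast
      from 1 2 show ?thesis
        unfolding Caret by (intro exI[of _ "ts @ ts'"] exI[of _ "us @ us'"]) simp
    qed
  qed
  then show ?thesis using that by blast
qed

text \<open>Grafting one list onto both trees inserts opposing carets. This preserves every relation
  between paired leaves that survives a common suffix, as representing a map and shifting parity
  do.\<close>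

lemma list_all2_graft:
  assumes "list_all2 P (leaves S) (leaves T)" "length ts = leaf_count S"
    and "\<And>v w x. P v w \<Longrightarrow> P (v @ x) (w @ x)"
  shows "list_all2 P (leaves (graft S ts)) (leaves (graft T ts))"
proof -
  have "list_all2 P (concat (map2 (\<lambda>v t. map ((@) v) (leaves t)) vs ts))
      (concat (map2 (\<lambda>v t. map ((@) v) (leaves t)) ws ts))"
    if "list_all2 P vs ws" for vs ws
    using that
  proof (induction vs ws arbitrary: ts rule: list_all2_induct)
    case (Cons v vs w ws)
    have "list_all2 P (map ((@) v) (leaves t)) (map ((@) w) (leaves t))" for t
      unfolding list.rel_map by (intro list.rel_refl_strong assms(3) Cons.hyps)
    then show ?case
      using Cons.IH by (cases ts) (simp_all add: list_all2_appendI)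
  qed simp
  then show ?thesis
    using assms(1,2) list_all2_lengthD[OF assms(1)] by (simp add: leaves_graft)
qed

lemma represents_graft:
  assumes "represents S T f" "length ts = leaf_count S"
  shows "represents (graft S ts) (graft T ts) f"
  using assms unfolding represents_iff
  by (rule list_all2_graft) (simp add: prefix_map_def)

text \<open>A common suffix alters both depths equally, and it keeps the first digits because the
  words are nonempty.\<close>

lemma parity_shift_graft:
  assumes "parity_shift e S T" "length ts = leaf_count S"
  shows "parity_shift e (graft S ts) (graft T ts)"
  using assms unfolding parity_shift_def
  by (rule list_all2_graft) (auto simp: planar_parity_def)

text \<open>Parities are two-valued, so two disagreements cancel: shifts compose with
  \<open>True\<close> as the neutral element.\<close>

lemma parity_shift_trans:
  assumes "parity_shift d S T" "parity_shift e T U"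
  shows "parity_shift (d = e) S U"
  using assms unfolding parity_shift_def list_all2_conv_all_nth by auto

lemma parity_shift_sym: "parity_shift e S T \<Longrightarrow> parity_shift e T S"
  unfolding parity_shift_def list_all2_conv_all_nth by auto

section \<open>The planar subgroup is generated by \<open>x0\<close> and a shifted copy\<close>

text \<open>Only extensionality is recorded; membership in \<open>F\<close> then follows by
  \<open>represented_in_carrier\<close>.\<close>

definition planar_diagram :: "bool \<Rightarrow> bintree \<Rightarrow> bintree \<Rightarrow> (real \<Rightarrow> real) \<Rightarrow> bool" where
  "planar_diagram e S T f \<longleftrightarrow> f \<in> extensional {0..1} \<and> represents S T f \<and> parity_shift e S T"

lemma leaf_count_Caret_gt_1: "1 < leaf_count (Caret l r)"
  using leaf_count_pos[of l] leaf_count_pos[of r] unfolding leaf_count_Caret by linarith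

lemma planar_subgroup_iff:
  "f \<in> planar_three_colorable_subgroup \<longleftrightarrow> (\<exists>e S T. planar_diagram e S T f)"
proof
  assume "f \<in> planar_three_colorable_subgroup"
  then obtain S T where f: "f \<in> extensional {0..1}" "represents S T f" "planar_three_colorable S T"
    by (auto simp: planar_three_colorable_subgroup_def)
  have diag: "tree_diagram S T" using f(2) by (simp add: represents_def)
  show "\<exists>e S T. planar_diagram e S T f"
  proof (cases S)
    case Tip
    then have "T = Tip"
      using diag leaf_count_Caret_gt_1 by (cases T) (auto simp: tree_diagram_def simp del: leaves.simps(2))
    \<comment> \<open>The single leaf of \<open>Tip\<close> is the empty word, which
      \<open>parity_shift\<close> excludes, so a pair of opposing carets is inserted first.\<close>
    with Tip f(2) have "represents (Caret Tip Tip) (Caret Tip Tip) f"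
      using represents_graft[of Tip Tip f "[Caret Tip Tip]"] by simp
    with f(1) have "planar_diagram True (Caret Tip Tip) (Caret Tip Tip) f"
      by (simp add: planar_diagram_def parity_shift_def)
    then show ?thesis by blast
  next
    case (Caret l r)
    obtain l' r' where "T = Caret l' r'"
      using diag Caret leaf_count_Caret_gt_1[of l r]
      by (cases T) (auto simp: tree_diagram_def simp del: leaves.simps(2))
    with Caret f diag show ?thesis
      unfolding planar_diagram_def using planar_three_colorable_iff by blast
  qed
next
  assume "\<exists>e S T. planar_diagram e S T f"
  then obtain e S T where f: "f \<in> extensional {0..1}" "represents S T f" "parity_shift e S T"
    by (auto simp: planar_diagram_def)
  obtain l r l' r' where "S = Caret l r" "T = Caret l' r'"
    using f(3) by (cases S; cases T) (auto simp: parity_shift_def list_all2_Cons1 list_all2_Cons2)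
  moreover have "tree_diagram S T" using f(2) by (simp add: represents_def)
  ultimately have "planar_three_colorable S T"
    using f(3) planar_three_colorable_iff by blast
  then show "f \<in> planar_three_colorable_subgroup"
    unfolding planar_three_colorable_subgroup_def
    using f represented_in_carrier by blast
qed

lemma three_colorable_subgroup_iff:
  "f \<in> three_colorable_subgroup \<longleftrightarrow>
    f \<in> extensional {0..1} \<and> (\<exists>S T. represents S T f \<and> same_depth_parities S T)"
proof -
  have "strip_three_colorable S T \<longleftrightarrow> same_depth_parities S T" if "represents S T f" for S T
    using that strip_three_colorable_iff by (simp add: represents_def)
  then show ?thesis
    unfolding three_colorable_subgroup_def using represented_in_carrier by auto
qed

lemma planar_diagram_mult:
  assumes "planar_diagram d S T f" "planar_diagram e T U g"
  shows "planar_diagram (d = e) S U (f \<otimes>\<^bsub>thompson_F\<^esub> g)"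
  using assms represents_mult parity_shift_trans
  by (auto simp: planar_diagram_def simp del: thompson_F_simps(2)) simp

lemma planar_subgroup_mult:
  assumes "f \<in> planar_three_colorable_subgroup" "g \<in> planar_three_colorable_subgroup"
  shows "f \<otimes>\<^bsub>thompson_F\<^esub> g \<in> planar_three_colorable_subgroup"
proof -
  obtain d S T e U V where f: "planar_diagram d S T f" and g: "planar_diagram e U V g"
    using assms planar_subgroup_iff by blast
  obtain ts us where ts: "length ts = leaf_count T" "length us = leaf_count U" "graft T ts = graft U us"
    by (rule common_refinement)
  have "length ts = leaf_count S"
    using f ts by (simp add: planar_diagram_def represents_def tree_diagram_def)
  then have "planar_diagram d (graft S ts) (graft T ts) f" "planar_diagram e (graft T ts) (graft V us) g"
    using f g ts represents_graft parity_shift_graft unfolding planar_diagram_def by metis+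
  then show ?thesis
    using planar_diagram_mult planar_subgroup_iff by blast
qed

lemma planar_diagram_inv:
  assumes "planar_diagram e S T f"
  shows "planar_diagram e T S (inv\<^bsub>thompson_F\<^esub> f)"
proof -
  have f: "represents S T f" "f \<in> extensional {0..1}" "parity_shift e S T"
    using assms by (simp_all add: planar_diagram_def)
  then have g: "represents T S (tree_map T S)"
    by (intro represents_tree_map) (simp add: represents_def tree_diagram_def)
  show ?thesis
    unfolding m_inv_eq_represented[OF f(1,2) g tree_map_extensional]
    using g f(3) by (simp add: planar_diagram_def parity_shift_sym tree_map_extensional)
qed

lemma planar_diagram_one:
  assumes "parity_shift True S S"
  shows "planar_diagram True S S \<one>\<^bsub>thompson_F\<^esub>"
  using assms binary_value_bounds
  by (simp add: planar_diagram_def represents_def tree_diagram_def)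

lemma one_in_planar_subgroup: "\<one>\<^bsub>thompson_F\<^esub> \<in> planar_three_colorable_subgroup"
  unfolding planar_subgroup_iff using planar_diagram_one[of "Caret Tip Tip"]
  by (fastforce simp: parity_shift_def simp del: thompson_F_simps)

lemma generate_subset_planar_subgroup:
  assumes "H \<subseteq> planar_three_colorable_subgroup"
  shows "generate thompson_F H \<subseteq> planar_three_colorable_subgroup"
proof
  fix f assume "f \<in> generate thompson_F H"
  then show "f \<in> planar_three_colorable_subgroup"
  proof (induction rule: generate.induct)
    case (inv h)
    then show ?case
      using assms planar_diagram_inv planar_subgroup_iff by blast
  qed (use assms one_in_planar_subgroup planar_subgroup_mult in blast)+
qed

section \<open>Rotations at the root\<close>

text \<open>Leaves of \<open>A\<close> lose one level and those of \<open>C\<close> gain one, with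
  the same first digit; those of \<open>B\<close> keep their depth but change their first digit. In
  every case planar parity flips.\<close>

lemma planar_diagram_x0:
  "planar_diagram False (Caret (Caret A B) C) (Caret A (Caret B C)) x0"
proof -
  have "prefix_map x0 (False # False # v) (False # v)"
    "prefix_map x0 (False # True # v) (True # False # v)"
    "prefix_map x0 (True # v) (True # True # v)" for v
    using x0_binary[of "v @- _"] by (simp_all add: prefix_map_def)
  then have "represents (Caret (Caret A B) C) (Caret A (Caret B C)) x0"
    by (simp add: represents_iff list.rel_map list_all2_appendI list.rel_refl)
  moreover have "parity_shift False (Caret (Caret A B) C) (Caret A (Caret B C))"
    by (simp add: parity_shift_def planar_parity_def list.rel_map list_all2_appendI list.rel_refl)
  ultimately show ?thesis
    by (simp add: planar_diagram_def x0_def)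
qed

lemma parity_shift_Caret_refl: "parity_shift True (Caret l r) (Caret l r)"
  by (simp add: parity_shift_def list_all2_appendI list.rel_map list.rel_refl)

text \<open>Each rotation by \<open>x0\<close> hands the right part of \<open>l\<close> over to the
  right subtree, so \<open>l\<close> shrinks while \<open>r\<close> grows; hence the induction on
  \<open>l\<close> with \<open>r\<close> arbitrary. The inverse \<open>h'\<close> is built along
  with \<open>h\<close>, since the rules of \<open>generate\<close> invert generators only.\<close>

lemma rotate_left_subtree_to_Tip:
  assumes "x0 \<in> H"
  shows "\<exists>A e. \<exists>h \<in> generate thompson_F H. \<exists>h' \<in> generate thompson_F H.
    planar_diagram e (Caret l r) (Caret Tip A) h \<and> planar_diagram e (Caret Tip A) (Caret l r) h'"
proof (induction l arbitrary: r)
  case Tip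
  show ?case
    using planar_diagram_one[OF parity_shift_Caret_refl, of Tip r] generate.one by blast
next
  case (Caret l1 l2)
  obtain A e h h' where h: "h \<in> generate thompson_F H" "h' \<in> generate thompson_F H"
      "planar_diagram e (Caret l1 (Caret l2 r)) (Caret Tip A) h"
      "planar_diagram e (Caret Tip A) (Caret l1 (Caret l2 r)) h'"
    using Caret.IH(1) by blast
  note rot = planar_diagram_x0[of l1 l2 r]
  have "planar_diagram (False = e) (Caret (Caret l1 l2) r) (Caret Tip A) (x0 \<otimes>\<^bsub>thompson_F\<^esub> h)"
    using planar_diagram_mult[OF rot h(3)] .
  moreover have "planar_diagram (e = False) (Caret Tip A) (Caret (Caret l1 l2) r)
      (h' \<otimes>\<^bsub>thompson_F\<^esub> inv\<^bsub>thompson_F\<^esub> x0)"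
    using planar_diagram_mult[OF h(4) planar_diagram_inv[OF rot]] .
  moreover have "x0 \<otimes>\<^bsub>thompson_F\<^esub> h \<in> generate thompson_F H"
    "h' \<otimes>\<^bsub>thompson_F\<^esub> inv\<^bsub>thompson_F\<^esub> x0 \<in> generate thompson_F H"
    using assms h by (auto intro: generate.intros simp del: thompson_F_simps)
  ultimately show ?case unfolding eq_commute[of False e] by blast
qed

text \<open>Mirror image: rotating by the inverse of \<open>x0\<close> hands the left part of
  \<open>r\<close> over to the left subtree.\<close>

lemma rotate_right_subtree_to_Tip:
  assumes "x0 \<in> H"
  shows "\<exists>A e. \<exists>h \<in> generate thompson_F H. \<exists>h' \<in> generate thompson_F H.
    planar_diagram e (Caret l r) (Caret A Tip) h \<and> planar_diagram e (Caret A Tip) (Caret l r) h'"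
proof (induction r arbitrary: l)
  case Tip
  show ?case
    using planar_diagram_one[OF parity_shift_Caret_refl, of l Tip] generate.one by blast
next
  case (Caret r1 r2)
  obtain A e h h' where h: "h \<in> generate thompson_F H" "h' \<in> generate thompson_F H"
      "planar_diagram e (Caret (Caret l r1) r2) (Caret A Tip) h"
      "planar_diagram e (Caret A Tip) (Caret (Caret l r1) r2) h'"
    using Caret.IH(2) by blast
  note rot = planar_diagram_x0[of l r1 r2]
  have "planar_diagram (False = e) (Caret l (Caret r1 r2)) (Caret A Tip)
      (inv\<^bsub>thompson_F\<^esub> x0 \<otimes>\<^bsub>thompson_F\<^esub> h)"
    using planar_diagram_mult[OF planar_diagram_inv[OF rot] h(3)] .
  moreover have "planar_diagram (e = False) (Caret A Tip) (Caret l (Caret r1 r2))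
      (h' \<otimes>\<^bsub>thompson_F\<^esub> x0)"
    using planar_diagram_mult[OF h(4) rot] .
  moreover have "inv\<^bsub>thompson_F\<^esub> x0 \<otimes>\<^bsub>thompson_F\<^esub> h \<in> generate thompson_F H"
    "h' \<otimes>\<^bsub>thompson_F\<^esub> x0 \<in> generate thompson_F H"
    using assms h by (auto intro: generate.intros simp del: thompson_F_simps)
  ultimately show ?case unfolding eq_commute[of False e] by blast
qed

section \<open>Shifts and their diagrams\<close>

lemma binary_value_le: "0 \<le> binary_value \<gamma>" "binary_value \<gamma> \<le> 1" "binary_value \<gamma> \<le> 2"
  using binary_value_bounds[of \<gamma>] by auto

lemma represents_shift_R:
  assumes "represents A B g" "g \<in> extensional {0..1}"
  shows "represents (Caret Tip A) (Caret Tip B) (shift_R g)"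
proof -
  have "prefix_map (shift_R g) [False] [False]"
    by (simp add: prefix_map_def shift_R_def binary_value_SCons binary_value_le)
  moreover have "prefix_map (shift_R g) (True # v) (True # w)" if "prefix_map g v w" for v w
    unfolding prefix_map_def
  proof
    fix \<gamma>
    let ?t = "binary_value (v @- \<gamma>)"
    have t: "?t \<in> {0..1}" by (rule binary_value_bounds)
    have "shift_R g ((1 + ?t) / 2) = (1 + g ?t) / 2"
    \<comment> \<open>At \<open>?t = 0\<close> the argument is \<open>1/2\<close>, where the
      definition takes the identity branch; the values agree because \<open>g 0 = 0\<close>.\<close>
    proof (cases "?t = 0")
      case True
      then show ?thesis using represents_0[OF assms] by (simp add: shift_R_def)
    next
      case False
      then show ?thesis using t by (simp add: shift_R_def field_simps)
    qed
    then show "shift_R g (binary_value ((True # v) @- \<gamma>)) = binary_value ((True # w) @- \<gamma>)"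
      using that by (simp add: prefix_map_def binary_value_SCons)
  qed
  ultimately show ?thesis
    using assms(1) unfolding represents_iff
    by (auto simp: list.rel_map elim: list_all2_mono)
qed

lemma represents_shift_L:
  assumes "represents A B g" "g \<in> extensional {0..1}"
  shows "represents (Caret A Tip) (Caret B Tip) (shift_L g)"
proof -
  have "prefix_map (shift_L g) [True] [True]"
    unfolding prefix_map_def
  proof
    fix \<gamma>
    have t: "binary_value \<gamma> \<in> {0..1}" by (rule binary_value_bounds)
    have "shift_L g ((1 + binary_value \<gamma>) / 2) = (1 + binary_value \<gamma>) / 2"
    \<comment> \<open>Here \<open>1/2\<close> falls under the scaled branch, which fixes it because
      \<open>g 1 = 1\<close>.\<close>
    proof (cases "binary_value \<gamma> = 0")
      case True
      then show ?thesis using represents_1[OF assms] by (simp add: shift_L_def)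
    next
      case False
      then show ?thesis using t by (simp add: shift_L_def)
    qed
    then show "shift_L g (binary_value ([True] @- \<gamma>)) = binary_value ([True] @- \<gamma>)"
      by (simp add: binary_value_SCons)
  qed
  moreover have "prefix_map (shift_L g) (False # v) (False # w)" if "prefix_map g v w" for v w
    using that by (simp add: prefix_map_def shift_L_def binary_value_SCons binary_value_le)
  ultimately show ?thesis
    using assms(1) unfolding represents_iff
    by (simp add: list.rel_map list_all2_appendI list_all2_mono[of "prefix_map g"])
qed

text \<open>The leaf of \<open>Tip\<close> is the same word in both trees, which forces
  \<open>e\<close>. All other leaves start with the same digit, so their planar parities compare
  depths.\<close>

lemma parity_shift_Tip_left_iff:
  "parity_shift e (Caret Tip A) (Caret Tip B) \<longleftrightarrow> e \<and> same_depth_parities A B"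
  by (auto simp: parity_shift_def same_depth_parities_def planar_parity_def list.rel_map
      elim: list_all2_mono)

lemma parity_shift_Tip_right_iff:
  "parity_shift e (Caret A Tip) (Caret B Tip) \<longleftrightarrow> e \<and> same_depth_parities A B"
proof -
  have "list_all2 P (xs @ [x]) (ys @ [y]) \<longleftrightarrow> list_all2 P xs ys \<and> P x y" for P xs ys and x y :: "bool list"
    by (cases "length xs = length ys") (auto simp: list_all2_append dest: list_all2_lengthD)
  then show ?thesis
    by (auto simp: parity_shift_def same_depth_parities_def planar_parity_def list.rel_map
        elim: list_all2_mono)
qed

text \<open>
  \<open>C A\<close> is the tree on which the shift \<open>\<phi>\<close> acts as on \<open>A\<close>: the caret with \<open>A\<close> on one side and a
  leaf on the other.
\<close>

lemma planar_subgroup_eq_generate: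
  fixes C :: "bintree \<Rightarrow> bintree" and \<phi> :: "(real \<Rightarrow> real) \<Rightarrow> real \<Rightarrow> real"
  defines "H \<equiv> {x0} \<union> \<phi> ` three_colorable_subgroup"
  assumes rotate: "\<And>l r. \<exists>A e. \<exists>h \<in> generate thompson_F H. \<exists>h' \<in> generate thompson_F H.
      planar_diagram e (Caret l r) (C A) h \<and> planar_diagram e (C A) (Caret l r) h'"
    and extensional: "\<And>g. \<phi> g \<in> extensional {0..1}"
    and represents: "\<And>A B g. represents A B g \<Longrightarrow> g \<in> extensional {0..1} \<Longrightarrow>
      represents (C A) (C B) (\<phi> g)"
    and parity: "\<And>e A B. parity_shift e (C A) (C B) \<longleftrightarrow> e \<and> same_depth_parities A B"
  shows "planar_three_colorable_subgroup = generate thompson_F H"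
proof
  have "\<phi> g \<in> planar_three_colorable_subgroup" if "g \<in> three_colorable_subgroup" for g
    using that represents extensional parity
    unfolding three_colorable_subgroup_iff planar_subgroup_iff planar_diagram_def by metis
  then have "H \<subseteq> planar_three_colorable_subgroup"
    using planar_diagram_x0 planar_subgroup_iff unfolding H_def by blast
  then show "generate thompson_F H \<subseteq> planar_three_colorable_subgroup"
    by (rule generate_subset_planar_subgroup)
next
  show "planar_three_colorable_subgroup \<subseteq> generate thompson_F H"
  proof
    fix f assume "f \<in> planar_three_colorable_subgroup"
    then obtain e S T where f: "planar_diagram e S T f" using planar_subgroup_iff by blast
    then obtain l r l' r' where S: "S = Caret l r" and T: "T = Caret l' r'"
      by (cases S; cases T) (auto simp: planar_diagram_def parity_shift_def list_all2_Cons1 list_all2_Cons2)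
    obtain A a h h' where h: "h \<in> generate thompson_F H"
      "planar_diagram a S (C A) h" "planar_diagram a (C A) S h'"
      using rotate[of l r] unfolding S by blast
    obtain B b k k' where k: "k' \<in> generate thompson_F H"
      "planar_diagram b T (C B) k" "planar_diagram b (C B) T k'"
      using rotate[of l' r'] unfolding T by blast
    \<comment> \<open>The product of \<open>h'\<close>, \<open>f\<close> and \<open>k\<close> has a
      diagram from \<open>C A\<close> to \<open>C B\<close>, so \<open>parity\<close> turns its
      parity shift into equal depth parities of \<open>A\<close> and \<open>B\<close>.\<close>
    note conj = planar_diagram_mult[OF h(3) planar_diagram_mult[OF f k(2)]]
    then have AB: "same_depth_parities A B"
      unfolding planar_diagram_def parity by blast
    then have "tree_diagram A B"
      by (auto simp: same_depth_parities_def tree_diagram_def dest: list_all2_lengthD)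
    then have g: "represents A B (tree_map A B)" by (rule represents_tree_map)
    define g where "g = \<phi> (tree_map A B)"
    have "tree_map A B \<in> three_colorable_subgroup"
      unfolding three_colorable_subgroup_iff using g AB tree_map_extensional by blast
    then have "g \<in> generate thompson_F H"
      unfolding g_def H_def by (intro generate.incl) blast
    then have gen: "h \<otimes>\<^bsub>thompson_F\<^esub> g \<otimes>\<^bsub>thompson_F\<^esub> k' \<in> generate thompson_F H"
      using h(1) k(1) by (intro generate.eng)
    have "planar_diagram True (C A) (C B) g"
      unfolding planar_diagram_def g_def parity
      using represents[OF g tree_map_extensional] extensional AB by blast
    \<comment> \<open>The product of \<open>h\<close>, \<open>g\<close> and \<open>k'\<close> is
      represented by the same pair \<open>S\<close>, \<open>T\<close> as \<open>f\<close>, and a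
      diagram determines its map.\<close>
    from planar_diagram_mult[OF planar_diagram_mult[OF h(2) this] k(3)]
    have "f = h \<otimes>\<^bsub>thompson_F\<^esub> g \<otimes>\<^bsub>thompson_F\<^esub> k'"
      using f represents_unique unfolding planar_diagram_def by blast
    with gen show "f \<in> generate thompson_F H" by simp
  qed
qed

theorem theorem2p6:
  "planar_three_colorable_subgroup
     = generate thompson_F ({x0} \<union> shift_R ` three_colorable_subgroup)
   \<and> planar_three_colorable_subgroup
     = generate thompson_F ({x0} \<union> shift_L ` three_colorable_subgroup)"
proof
  \<comment> \<open>\<open>shift_R\<close> is the identity on the left half, so here
    \<open>C A\<close> is \<open>Caret Tip A\<close>; for \<open>shift_L\<close> it is
    \<open>Caret A Tip\<close>.\<close>
  show "planar_three_colorable_subgroup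
     = generate thompson_F ({x0} \<union> shift_R ` three_colorable_subgroup)"
    by (rule planar_subgroup_eq_generate[OF rotate_left_subtree_to_Tip _ represents_shift_R
          parity_shift_Tip_left_iff]) (simp_all add: shift_R_def)
  show "planar_three_colorable_subgroup
     = generate thompson_F ({x0} \<union> shift_L ` three_colorable_subgroup)"
    by (rule planar_subgroup_eq_generate[OF rotate_right_subtree_to_Tip _ represents_shift_L
          parity_shift_Tip_right_iff]) (simp_all add: shift_L_def)
qed

end
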